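(* Let $m>n$ be positive integers. There is a map $\Psi:\mathcal{D}_{m,n}\to\mathcal{D}_{m,n}$ such that for every $P\in\mathcal{D}_{m,n}$: $\Psi(\Psi(P))=P$, $\mathrm{comp}(\Psi(P))=\mathrm{comp}(P)$, $\widetilde{\mathrm{run}}(\Psi(P))=\mathrm{ret}(P)$ and $\mathrm{ret}(\Psi(P))=\widetilde{\mathrm{run}}(P)$.
   Context: An $m\times n$ rational Dyck path is a lattice path from $(0,0)$ to $(m,n)$ using unit north steps $N$ and east steps $E$ that stays weakly above the line $y=nx/m$; $\mathcal{D}_{m,n}$ is the set of these paths. For $P\in\mathcal{D}_{m,n}$, let $(u_1,\dots,u_n)$ be its coarea sequence, $u_i$ being the $x$-coordinate of the $i$-th north step of $P$ (bottom to top). With $k=\lfloor m/n\rfloor$, the ratio-run statistic is $\widetilde{\mathrm{run}}(P)=\min\{i\in\{1,\dots,n\}: ki\notin\{u_1,\dots,u_n\}\}$. The return statistic $\mathrm{ret}(P)$ is the number of north steps of $P$ from some $(i,j)$ to $(i,j+1)$ with $jm-in<n$. The composition type $\mathrm{comp}(P)$ is the composition of $n$ given by the lengths of the maximal blocks of consecutive north steps of $P$, in order. *)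

theory Defs
  imports Complex_Main "HOL-Library.FuncSet"
begin

datatype step = N | E

type_synonym path = "step list"

text \<open>Paths start at the origin; \<open>point P t\<close> is the lattice point reached after the
  first \<open>t\<close> steps, so the \<open>t\<close>-th step (counting from 0) starts at \<open>point P t\<close>.\<close>

definition point :: "path \<Rightarrow> nat \<Rightarrow> nat \<times> nat" where
  "point P t = (count_list (take t P) E, count_list (take t P) N)"

text \<open>A path consists of unit segments, so it is weakly above a line as soon as all its
  lattice points are.\<close>

definition dyck_paths :: "nat \<Rightarrow> nat \<Rightarrow> path set" where
  "dyck_paths m n = {P. point P (length P) = (m, n) \<and>
     (\<forall>t \<le> length P. case point P t of (x, y) \<Rightarrow> real y \<ge> real n * real x / real m)}"

definition coarea :: "path \<Rightarrow> nat list" where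
  "coarea P = map (\<lambda>t. fst (point P t)) (filter (\<lambda>t. P ! t = N) [0..<length P])"

text \<open>For \<open>0 < n \<le> m\<close> and \<open>P \<in> dyck_paths m n\<close> the set below is nonempty: the
  \<open>n\<close> candidates \<open>(m div n) * i\<close> are distinct and positive, while the coarea sequence has
  \<open>n\<close> entries, the first of which is 0.\<close>

definition ratio_run :: "nat \<Rightarrow> nat \<Rightarrow> path \<Rightarrow> nat" where
  "ratio_run m n P = Min {i \<in> {1..n}. (m div n) * i \<notin> set (coarea P)}"

definition ret :: "nat \<Rightarrow> nat \<Rightarrow> path \<Rightarrow> nat" where
  "ret m n P = card {t. t < length P \<and> P ! t = N \<and>
     (case point P t of (i, j) \<Rightarrow> int j * int m - int i * int n < int n)}"

function comp_type :: "path \<Rightarrow> nat list" where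
  "comp_type [] = []"
| "comp_type (E # P) = comp_type P"
| "comp_type (N # P) =
     Suc (length (takeWhile (\<lambda>s. s = N) P)) # comp_type (dropWhile (\<lambda>s. s = N) P)"
  by pat_completeness auto
termination
  by (relation "measure length") (simp_all add: length_dropWhile_le le_imp_less_Suc)

end

theory Submission
  imports Defs
begin

text \<open>
  Since the \<open>\<Psi>\<close> sought is only required to be an involution, it suffices that the pair
  (ratio-run, return) is symmetrically distributed on the paths of each composition type \<open>c\<close>.
  Such a path is determined by the columns \<open>w\<^sub>1 < \<dots> < w\<^sub>l\<close> of its blocks, subject to
  \<open>w\<^sub>s \<le> B\<^sub>s\<close>, where \<open>B\<^sub>s = \<lfloor>m y\<^sub>s / n\<rfloor>\<close> and \<open>y\<^sub>s\<close> is the height at which block \<open>s\<close> starts;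
  consecutive bounds differ by at least \<open>k = \<lfloor>m / n\<rfloor>\<close>. The returns are the \<open>s\<close> with
  \<open>w\<^sub>s = B\<^sub>s\<close>, and the run counts the initial multiples of \<open>k\<close> present in \<open>w\<close>. Scan the
  columns \<open>x = 0, 1, \<dots>\<close> and record whether \<open>x\<close> is in \<open>w\<close>. As long as the first remaining bound
  coincides with the next multiple of \<open>k\<close>, either both statistics increase together or the
  scan moves strictly off that bound. Once the first bound exceeds the next multiple of \<open>k\<close>, the
  number of \<open>w\<close> with run \<open>a\<close> and \<open>b\<close> returns depends only on \<open>a + b\<close>: it is the number of
  increasing sequences with entries at least \<open>x + a + b + 2\<close> bounded by \<open>B\<close> without its
  first \<open>a + b\<close> terms.
\<close>

section \<open>Bounded increasing sequences\<close>

fun bounded_chain :: "nat \<Rightarrow> nat list \<Rightarrow> nat list \<Rightarrow> bool" where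
  "bounded_chain x [] [] = True"
| "bounded_chain x (b # B) (v # w) = (x \<le> v \<and> v \<le> b \<and> bounded_chain (Suc v) B w)"
| "bounded_chain x _ _ = False"

text \<open>This is the number of \<open>w\<close> with \<open>bounded_chain x B w\<close>, obtained
  by scanning: column \<open>x\<close> is either skipped, or it is the first entry and consumes the
  bound \<open>b\<close>. The induction rule drives the scan arguments below.\<close>

function chain_count :: "nat \<Rightarrow> nat list \<Rightarrow> nat" where
  "chain_count x [] = 1"
| "chain_count x (b # B) =
     (if b < x then 0 else chain_count (Suc x) (b # B) + chain_count (Suc x) B)"
  by pat_completeness auto
termination
  by (relation "measures [\<lambda>(x, B). length B, \<lambda>(x, B). Suc (hd B) - x]") auto

declare chain_count.simps(2) [simp del]

lemma bounded_chain_Nil [simp]: "bounded_chain x [] w \<longleftrightarrow> w = []"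
  by (cases w) auto

lemma bounded_chain_mono: "bounded_chain y B w \<Longrightarrow> x \<le> y \<Longrightarrow> bounded_chain x B w"
  by (cases "(x, B, w)" rule: bounded_chain.cases) auto

lemma bounded_chain_length: "bounded_chain x B w \<Longrightarrow> length w = length B"
  by (induction x B w rule: bounded_chain.induct) auto

lemma bounded_chain_ge: "bounded_chain x B w \<Longrightarrow> v \<in> set w \<Longrightarrow> x \<le> v"
  by (induction x B w rule: bounded_chain.induct) auto

lemma bounded_chain_sorted: "bounded_chain x B w \<Longrightarrow> sorted_wrt (<) w"
  by (induction x B w rule: bounded_chain.induct)
     (auto dest: bounded_chain_ge simp: Suc_le_eq)

lemma bounded_chain_empty: "b < x \<Longrightarrow> \<not> bounded_chain x (b # B) w"
  by (cases w) auto

lemma bounded_chain_split: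
  assumes "x \<le> b"
  shows "bounded_chain x (b # B) w \<longleftrightarrow>
    bounded_chain (Suc x) (b # B) w \<or> (\<exists>w'. w = x # w' \<and> bounded_chain (Suc x) B w')"
proof (cases w)
  case (Cons v w')
  with assms show ?thesis
    by (cases "x = v") auto
qed simp

lemma finite_bounded_chain: "finite {w. bounded_chain x B w}"
proof (induction x B rule: chain_count.induct)
  case (2 x b B)
  show ?case
  proof (cases "b < x")
    case False
    then have "{w. bounded_chain x (b # B) w} =
      {w. bounded_chain (Suc x) (b # B) w} \<union> (#) x ` {w. bounded_chain (Suc x) B w}"
      by (auto simp: bounded_chain_split)
    with 2 False show ?thesis by simp
  qed (simp add: bounded_chain_empty)
qed simp

text \<open>One step of the scan at the level of cardinalities; an arbitrary \<open>Q\<close> lets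
  the same split serve both statistics, together or alone.\<close>

lemma card_bounded_chain_split:
  assumes "x \<le> b"
  shows "card {w. bounded_chain x (b # B) w \<and> Q w} =
    card {w. bounded_chain (Suc x) (b # B) w \<and> Q w} +
    card {w. bounded_chain (Suc x) B w \<and> Q (x # w)}"
proof -
  let ?A = "{w. bounded_chain (Suc x) (b # B) w \<and> Q w}"
  let ?C = "{w. bounded_chain (Suc x) B w \<and> Q (x # w)}"
  have eq: "{w. bounded_chain x (b # B) w \<and> Q w} = ?A \<union> (#) x ` ?C"
    using bounded_chain_split[OF assms] by auto
  have "finite ?A" "finite ?C"
    by (rule finite_subset[OF _ finite_bounded_chain], blast)+
  moreover have "?A \<inter> (#) x ` ?C = {}"
    by auto
  ultimately show ?thesis
    unfolding eq by (simp add: card_Un_disjoint card_image)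
qed

abbreviation spaced :: "nat \<Rightarrow> nat list \<Rightarrow> bool" where
  "spaced k \<equiv> successively (\<lambda>u v. u + k \<le> v)"

lemma spaced_nth: "spaced k (b # B) \<Longrightarrow> 1 \<le> k \<Longrightarrow> t \<le> length B \<Longrightarrow> b + t \<le> (b # B) ! t"
proof (induction B arbitrary: b t)
  case (Cons c B)
  show ?case
  proof (cases t)
    case (Suc t')
    then have "c + t' \<le> (c # B) ! t'"
      using Cons by auto
    then show ?thesis using Cons.prems Suc by auto
  qed simp
qed simp

section \<open>Distribution of the number of touched bounds\<close>

definition touches :: "nat list \<Rightarrow> nat list \<Rightarrow> nat" where
  "touches B w = length (filter (\<lambda>(b, v). v = b) (zip B w))"

lemma touches_simps [simp]:
  "touches [] w = 0"
  "touches B [] = 0"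
  "touches (b # B) (v # w) = (if v = b then 1 else 0) + touches B w"
  by (auto simp: touches_def)

text \<open>The explicit 0 matters: for \<open>t > length B\<close> the dropped list is empty and
  \<open>chain_count\<close> would return 1.\<close>

definition tail_count :: "nat \<Rightarrow> nat list \<Rightarrow> nat \<Rightarrow> nat" where
  "tail_count x B t = (if t \<le> length B then chain_count (x + t) (drop t B) else 0)"

text \<open>The spacing keeps the first surviving bound at or above \<open>x + t\<close>, so
  \<open>chain_count\<close> unfolds on the shortened list. Tail counts thus obey the recursion of
  the scan.\<close>

lemma tail_count_rec:
  assumes "spaced k (b # B)" "1 \<le> k" "x \<le> b"
  shows "tail_count x (b # B) t = tail_count (Suc x) (b # B) t + tail_count (Suc x) B t"
proof -
  consider "t \<le> length B" | "t = Suc (length B)" | "t > Suc (length B)"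
    by linarith
  then show ?thesis
  proof cases
    case 1
    have "drop t (b # B) = (b # B) ! t # drop t B"
      using 1 Cons_nth_drop_Suc[of t "b # B"] by simp
    moreover have "x + t \<le> (b # B) ! t"
      using spaced_nth[OF assms(1,2) 1] assms(3) by simp
    ultimately show ?thesis
      using 1 by (simp add: tail_count_def chain_count.simps(2))
  qed (auto simp: tail_count_def)
qed

text \<open>Both sides follow the same recursion until \<open>x\<close> reaches the first bound
  \<open>b\<close>. There the next entry must be \<open>b\<close>, which costs one touch and one
  bound.\<close>

lemma card_touches:
  assumes "spaced k B" "1 \<le> k" "B \<noteq> [] \<Longrightarrow> x \<le> hd B"
  shows "card {w. bounded_chain x B w \<and> touches B w = t} = tail_count (Suc x) B t"
  using assms
proof (induction x B arbitrary: t rule: chain_count.induct)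
  case (1 x)
  have "{w. bounded_chain x [] w \<and> touches [] w = t} = (if t = 0 then {[]} else {})"
    by auto
  then show ?case by (simp add: tail_count_def)
next
  case (2 x b B)
  then have "x \<le> b" by simp
  have sp: "spaced k B" "B \<noteq> [] \<Longrightarrow> b + k \<le> hd B"
    using 2 by (auto simp: successively_Cons)
  have nxt: "Suc x \<le> hd B" if "B \<noteq> []"
    using sp(2)[OF that] \<open>x \<le> b\<close> \<open>1 \<le> k\<close> by linarith
  have IH2: "card {w. bounded_chain (Suc x) B w \<and> touches B w = s} = tail_count (Suc (Suc x)) B s" for s
    using 2 sp nxt \<open>x \<le> b\<close> by (intro "2.IH"(2)) auto
  show ?case
  proof (cases "x = b")
    case False
    then have "card {w. bounded_chain (Suc x) (b # B) w \<and> touches (b # B) w = t} =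
      tail_count (Suc (Suc x)) (b # B) t"
      using 2 \<open>x \<le> b\<close> by (intro "2.IH"(1)) auto
    then show ?thesis
      using tail_count_rec[of k b B "Suc x" t] 2 IH2[of t] False \<open>x \<le> b\<close>
      by (simp add: card_bounded_chain_split)
  next
    case True
    then show ?thesis
    proof (cases t)
      case 0
      then show ?thesis
        using True
        by (simp add: card_bounded_chain_split bounded_chain_empty tail_count_def chain_count.simps(2))
    next
      case (Suc s)
      then show ?thesis
        using True IH2[of s]
        by (simp add: card_bounded_chain_split bounded_chain_empty tail_count_def)
    qed
  qed
qed

section \<open>Joint distribution of the initial run and the touched bounds\<close>

definition run_from :: "nat \<Rightarrow> nat \<Rightarrow> nat \<Rightarrow> nat set \<Rightarrow> bool" where
  "run_from k j a S \<longleftrightarrow> (\<forall>i<a. k * (j + i) \<in> S) \<and> k * (j + a) \<notin> S"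

lemma run_from_unique: "run_from k j a S \<Longrightarrow> run_from k j a' S \<Longrightarrow> a = a'"
  unfolding run_from_def by (metis nat_neq_iff)

lemma run_from_insert_irrelevant:
  assumes "x < k * j"
  shows "run_from k j a (insert x S) \<longleftrightarrow> run_from k j a S"
proof -
  have "k * (j + i) \<noteq> x" for i
    using assms by (simp add: distrib_left)
  then show ?thesis by (simp add: run_from_def)
qed

text \<open>Since \<open>1 \<le> k\<close>, all later multiples differ from the inserted one, so the
  rest of the run is read off from \<open>S\<close> alone.\<close>

lemma run_from_insert:
  assumes "1 \<le> k"
  shows "run_from k j a (insert (k * j) S) \<longleftrightarrow> (\<exists>a'. a = Suc a' \<and> run_from k (Suc j) a' S)"
proof (cases a)
  case (Suc a')
  have "k * (j + Suc i) \<noteq> k * j" for i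
    using assms by (simp add: add_mult_distrib2)
  then show ?thesis
    using assms Suc by (auto simp: run_from_def All_less_Suc2)
qed (simp add: run_from_def)

lemma run_from_notin: "k * j \<notin> S \<Longrightarrow> run_from k j a S \<longleftrightarrow> a = 0"
  by (cases a) (auto simp: run_from_def)

definition joint_count :: "nat \<Rightarrow> nat \<Rightarrow> nat \<Rightarrow> nat list \<Rightarrow> nat \<Rightarrow> nat \<Rightarrow> nat" where
  "joint_count k x j B a b =
     card {w. bounded_chain x B w \<and> run_from k j a (set w) \<and> touches B w = b}"

lemma joint_count_Nil: "joint_count k x j [] a b = (if a = 0 \<and> b = 0 then 1 else 0)"
proof -
  have "{w. bounded_chain x [] w \<and> run_from k j a (set w) \<and> touches [] w = b} =
    (if a = 0 \<and> b = 0 then {[]} else {})"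
    by (auto simp: run_from_notin)
  then show ?thesis by (simp add: joint_count_def)
qed

lemma joint_count_skip:
  assumes "x < k * j" "x < b"
  shows "joint_count k x j (b # B) r t =
    joint_count k (Suc x) j (b # B) r t + joint_count k (Suc x) j B r t"
  using assms
  by (simp add: joint_count_def card_bounded_chain_split run_from_insert_irrelevant)

text \<open>Before column \<open>k * j\<close> both sides split by the same recursion. At
  \<open>k * j\<close>, skipping ends the run and leaves a count by touches alone; taking it lowers
  \<open>r\<close> by one and drops a bound, which matches a shift of \<open>tail_count\<close> by
  one.\<close>

lemma joint_count_loose:
  assumes "spaced k B" "1 \<le> k" "x \<le> k * j" "B \<noteq> [] \<Longrightarrow> k * j < hd B"
  shows "joint_count k x j B r t = tail_count (x + 2) B (r + t)"
  using assms
proof (induction x B arbitrary: j r t rule: chain_count.induct)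
  case (1 x)
  then show ?case by (simp add: joint_count_Nil tail_count_def)
next
  case (2 x b B)
  have b: "k * j < b" "x < b" using 2 by auto
  have sp: "spaced k B" "B \<noteq> [] \<Longrightarrow> b + k \<le> hd B"
    using 2 by (auto simp: successively_Cons)
  \<comment> \<open>The next bound is larger by at least \<open>k\<close>, so the strict gap
    survives the passage from \<open>j\<close> to \<open>Suc j\<close>.\<close>
  have nxt: "k * Suc j < hd B" if "B \<noteq> []"
    using sp(2)[OF that] b by simp
  then have nxt': "k * j < hd B" if "B \<noteq> []"
    using that by fastforce
  show ?case
  proof (cases "x = k * j")
    case False
    then have "x < k * j" using 2 by simp
    have "joint_count k (Suc x) j (b # B) r t = tail_count (Suc x + 2) (b # B) (r + t)"
      using 2 b \<open>x < k * j\<close> by (intro "2.IH"(1)) auto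
    moreover have "joint_count k (Suc x) j B r t = tail_count (Suc x + 2) B (r + t)"
      using "2.prems" b \<open>x < k * j\<close> sp nxt' by (intro "2.IH"(2)) auto
    ultimately show ?thesis
      using joint_count_skip[OF \<open>x < k * j\<close> b(2)] tail_count_rec[of k b B "x + 2" "r + t"]
        2 b \<open>x < k * j\<close> by simp
  next
    case True
    have notin: "k * j \<notin> set w" if "bounded_chain (Suc x) C w" for C w
      using bounded_chain_ge[OF that, of x] True by auto
    have *: "joint_count k x j (b # B) r t =
      card {w. bounded_chain (Suc x) (b # B) w \<and> r = 0 \<and> touches (b # B) w = t} +
      card {w. bounded_chain (Suc x) B w \<and> run_from k j r (insert (k * j) (set w)) \<and> touches B w = t}"
      using b True unfolding joint_count_def
      by (subst card_bounded_chain_split)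
         (auto intro!: arg_cong2[where f = plus] arg_cong[where f = card] simp: run_from_notin notin)
    show ?thesis
    proof (cases r)
      case 0
      \<comment> \<open>Source of the offset 2: one unit for the skipped column, one from
        \<open>card_touches\<close>.\<close>
      then show ?thesis
        using * card_touches[of k "b # B" "Suc x" t] 2 b
        by (simp add: run_from_insert)
    next
      case (Suc s)
      have "joint_count k (Suc x) (Suc j) B s t = tail_count (Suc x + 2) B (s + t)"
        using "2.prems" b True sp nxt by (intro "2.IH"(2)) auto
      then show ?thesis
        using * Suc 2 by (simp add: run_from_insert joint_count_def tail_count_def)
    qed
  qed
qed

text \<open>If the first bound lies beyond \<open>k * j\<close>, the loose formula is visibly
  symmetric. If they coincide, the scan either has not reached them, or it must take that column and
  both statistics grow.\<close>

lemma joint_count_sym: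
  assumes "spaced k B" "1 \<le> k" "x \<le> k * j" "B \<noteq> [] \<Longrightarrow> k * j \<le> hd B"
  shows "joint_count k x j B r t = joint_count k x j B t r"
  using assms
proof (induction x B arbitrary: j r t rule: chain_count.induct)
  case (1 x)
  then show ?case by (simp add: joint_count_Nil)
next
  case (2 x b B)
  have sp: "spaced k B" "B \<noteq> [] \<Longrightarrow> b + k \<le> hd B"
    using 2 by (auto simp: successively_Cons)
  have nxt: "b < hd B" and nxt': "k * Suc j \<le> hd B" if "B \<noteq> []"
    using sp(2)[OF that] 2 by auto
  consider "k * j < b" | "k * j = b" "x < b" | "k * j = b" "x = b"
    using 2 by fastforce
  then show ?case
  proof cases
    case 1
    then show ?thesis
      using 2 by (simp add: joint_count_loose add.commute)
  next
    case 2
    note eq = this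
    have "joint_count k (Suc x) j (b # B) r t = joint_count k (Suc x) j (b # B) t r"
      using "2.prems" eq by (intro "2.IH"(1)) auto
    \<comment> \<open>Taking \<open>x < b\<close> uses up the bound \<open>b\<close> without
      touching it; the next bound exceeds \<open>k * j\<close> strictly, so the loose formula
      applies.\<close>
    moreover have "joint_count k (Suc x) j B r' t' = tail_count (Suc x + 2) B (r' + t')" for r' t'
      using "2.prems" eq sp nxt by (intro joint_count_loose) auto
    ultimately show ?thesis
      using eq by (simp add: joint_count_skip add.commute)
  next
    case 3
    \<comment> \<open>Skipping column \<open>b\<close> is impossible, so \<open>b\<close> is an
      entry and contributes one to each statistic.\<close>
    have step: "joint_count k x j (b # B) r t =
      card {w. bounded_chain (Suc x) B w \<and> (\<exists>r'. r = Suc r' \<and> run_from k (Suc j) r' (set w)) \<and>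
        Suc (touches B w) = t}" for r t
      using 3 "2.prems"(2) run_from_insert[of k j r]
      unfolding joint_count_def by (subst card_bounded_chain_split) (auto simp: bounded_chain_empty)
    show ?thesis
    proof (cases "r = 0 \<or> t = 0")
      case True
      then show ?thesis by (auto simp: step)
    next
      case False
      then obtain r' t' where "r = Suc r'" "t = Suc t'"
        by (metis not0_implies_Suc)
      moreover have "joint_count k (Suc x) (Suc j) B r' t' = joint_count k (Suc x) (Suc j) B t' r'"
        using "2.prems" 3 sp nxt' by (intro "2.IH"(2)) auto
      ultimately show ?thesis
        unfolding step by (simp add: joint_count_def)
    qed
  qed
qed


section \<open>Paths with prescribed composition type\<close>

fun stays_above :: "nat \<Rightarrow> nat \<Rightarrow> nat \<Rightarrow> nat \<Rightarrow> path \<Rightarrow> bool" where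
  "stays_above m n x y [] \<longleftrightarrow> x = m \<and> y = n"
| "stays_above m n x y (E # P) \<longleftrightarrow> Suc x * n \<le> y * m \<and> stays_above m n (Suc x) y P"
| "stays_above m n x y (N # P) \<longleftrightarrow> stays_above m n x (Suc y) P"

fun north_columns :: "nat \<Rightarrow> path \<Rightarrow> nat set" where
  "north_columns x [] = {}"
| "north_columns x (E # P) = north_columns (Suc x) P"
| "north_columns x (N # P) = insert x (north_columns x P)"

fun returns :: "nat \<Rightarrow> nat \<Rightarrow> nat \<Rightarrow> nat \<Rightarrow> path \<Rightarrow> nat" where
  "returns m n x y [] = 0"
| "returns m n x y (E # P) = returns m n (Suc x) y P"
| "returns m n x y (N # P) = (if y * m < x * n + n then 1 else 0) + returns m n x (Suc y) P"

lemma point_0: "point P 0 = (0, 0)"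
  by (simp add: point_def)

lemma point_Cons_Suc:
  "point (s # P) (Suc t) =
    (if s = E then (Suc (fst (point P t)), snd (point P t))
     else (fst (point P t), Suc (snd (point P t))))"
  by (cases s) (auto simp: point_def)

text \<open>Testing the line after east steps suffices, as a north step cannot cross below it. The
  recursion never tests its starting point, hence the extra conjunct on the left.\<close>

lemma stays_above_iff:
  "x * n \<le> y * m \<and> stays_above m n x y P \<longleftrightarrow>
    x + count_list P E = m \<and> y + count_list P N = n \<and>
    (\<forall>t \<le> length P. (x + fst (point P t)) * n \<le> (y + snd (point P t)) * m)"
proof (induction m n x y P rule: stays_above.induct)
  case (1 m n x y)
  then show ?case by (auto simp: point_0 mult.commute)
next
  case (2 m n x y P)
  have "(\<forall>t \<le> length (E # P). (x + fst (point (E # P) t)) * n \<le> (y + snd (point (E # P) t)) * m)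
    \<longleftrightarrow> x * n \<le> y * m \<and>
      (\<forall>t \<le> length P. (Suc x + fst (point P t)) * n \<le> (y + snd (point P t)) * m)"
    unfolding length_Cons le_simps(2)[symmetric] All_less_Suc2
    by (simp add: point_0 point_Cons_Suc)
  with 2 show ?case by auto
next
  case (3 m n x y P)
  have "(\<forall>t \<le> length (N # P). (x + fst (point (N # P) t)) * n \<le> (y + snd (point (N # P) t)) * m)
    \<longleftrightarrow> x * n \<le> y * m \<and>
      (\<forall>t \<le> length P. (x + fst (point P t)) * n \<le> (Suc y + snd (point P t)) * m)"
    unfolding length_Cons le_simps(2)[symmetric] All_less_Suc2
    by (simp add: point_0 point_Cons_Suc)
  with 3 show ?case by auto
qed

lemma dyck_paths_iff:
  assumes "0 < m"
  shows "P \<in> dyck_paths m n \<longleftrightarrow> stays_above m n 0 0 P"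
proof -
  have "real n * real x / real m \<le> real y \<longleftrightarrow> x * n \<le> y * m" for x y
  proof -
    have "real n * real x / real m \<le> real y \<longleftrightarrow> real (x * n) \<le> real (y * m)"
      using assms by (simp add: pos_divide_le_eq mult.commute)
    then show ?thesis by (simp only: of_nat_le_iff)
  qed
  then show ?thesis
    using stays_above_iff[of 0 n 0 m P]
    by (auto simp: dyck_paths_def point_def)
qed

lemma Collect_less_Suc:
  "{t. t < Suc l \<and> Q t} = (if Q 0 then {0} else {}) \<union> Suc ` {t. t < l \<and> Q (Suc t)}"
proof (rule set_eqI)
  fix t
  show "t \<in> {t. t < Suc l \<and> Q t} \<longleftrightarrow>
    t \<in> (if Q 0 then {0} else {}) \<union> Suc ` {t. t < l \<and> Q (Suc t)}"
    by (cases t) auto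
qed

lemma set_coarea: "set (coarea P) = north_columns 0 P"
proof -
  have "(\<lambda>t. x + fst (point P t)) ` {t. t < length P \<and> P ! t = N} = north_columns x P" for x
    by (induction x P rule: north_columns.induct)
       (simp_all add: Collect_less_Suc image_Un image_image point_Cons_Suc point_0)
  from this[of 0] show ?thesis
    by (simp add: coarea_def)
qed

lemma ret_eq_returns: "ret m n P = returns m n 0 0 P"
proof -
  have *: "card {t. t < length P \<and> P ! t = N \<and>
    (y + snd (point P t)) * m < (x + fst (point P t)) * n + n} = returns m n x y P" for x y
    by (induction m n x y P rule: returns.induct)
       (simp_all add: Collect_less_Suc card_image point_Cons_Suc point_0)
  have "int j * int m - int i * int n < int n \<longleftrightarrow> j * m < i * n + n" for i j
  proof -
    have "int j * int m - int i * int n < int n \<longleftrightarrow> int (j * m) < int (i * n + n)"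
      by (auto simp: algebra_simps)
    then show ?thesis by (simp only: of_nat_less_iff)
  qed
  with *[of 0 0] show ?thesis
    unfolding ret_def by (simp add: case_prod_beta)
qed

section \<open>Encoding of paths by the columns of their blocks\<close>

fun block_path :: "nat \<Rightarrow> nat \<Rightarrow> nat list \<Rightarrow> nat list \<Rightarrow> path" where
  "block_path m x (c # cs) (v # w) = replicate (v - x) E @ replicate c N @ block_path m v cs w"
| "block_path m x _ _ = replicate (m - x) E"

fun block_bounds :: "nat \<Rightarrow> nat \<Rightarrow> nat \<Rightarrow> nat list \<Rightarrow> nat list" where
  "block_bounds m n y [] = []"
| "block_bounds m n y (c # cs) = (y * m div n) # block_bounds m n (y + c) cs"

lemma length_block_bounds [simp]: "length (block_bounds m n y c) = length c"
  by (induction m n y c rule: block_bounds.induct) auto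

lemma div_ge_iff: "0 < n \<Longrightarrow> v \<le> y * m div n \<longleftrightarrow> v * n \<le> y * m" for n :: nat
  by (rule less_eq_div_iff_mult_less_eq)

text \<open>Each block is nonempty, so the height grows by at least one, and floors are
  superadditive.\<close>

lemma spaced_block_bounds:
  assumes "0 \<notin> set c"
  shows "spaced (m div n) (block_bounds m n y c)"
  using assms
proof (induction c arbitrary: y)
  case (Cons a c)
  have "y * m div n + m div n \<le> (y * m + m) div n"
    by (subst div_add1_eq) simp
  also have "\<dots> \<le> (y + a) * m div n"
    using Cons.prems by (intro div_le_mono) (cases a, auto)
  finally show ?case
    using Cons by (cases c) auto
qed simp

lemma comp_type_replicate_E [simp]: "comp_type (replicate i E @ P) = comp_type P"
  "comp_type (replicate i E) = []"
  by (induction i) auto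

lemma comp_type_replicate_N:
  assumes "0 < i" "P = [] \<or> hd P = E"
  shows "comp_type (replicate i N @ P) = i # comp_type P"
proof -
  have "takeWhile (\<lambda>s. s = N) P = []" "dropWhile (\<lambda>s. s = N) P = P"
    using assms(2) by (cases P; auto)+
  moreover have "replicate i N = N # replicate (i - 1) N"
    using assms(1) by (cases i) auto
  ultimately show ?thesis
    using assms(1) by (simp add: takeWhile_append dropWhile_append)
qed

lemma hd_replicate_append: "0 < i \<Longrightarrow> hd (replicate i a @ P) = a"
  by (cases i) auto

text \<open>Starting the chain at \<open>Suc x\<close> forces an east step before the next block, so
  it cannot merge with a block in column \<open>x\<close>.\<close>

lemma block_path_hd:
  assumes "bounded_chain (Suc x) B w"
  shows "block_path m x c w = [] \<or> hd (block_path m x c w) = E"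
proof (cases "c = [] \<or> w = []")
  case True
  then have "block_path m x c w = replicate (m - x) E @ []"
    by (cases c) (auto split: list.splits)
  then show ?thesis
    using hd_replicate_append[of "m - x" E "[]"] by (cases "m - x") auto
next
  case False
  then obtain a cs v w' where "c = a # cs" "w = v # w'"
    by (meson list.exhaust)
  with assms show ?thesis
    by (cases B) (auto simp: hd_replicate_append)
qed

lemma comp_type_block_path:
  assumes "bounded_chain x B w" "0 \<notin> set c" "length B = length c"
  shows "comp_type (block_path m x c w) = c"
  using assms
proof (induction c arbitrary: x B w)
  case Nil
  then show ?case by simp
next
  case (Cons a c)
  then obtain b B' v w' where [simp]: "B = b # B'" "w = v # w'"
    by (cases "(x, B, w)" rule: bounded_chain.cases) auto
  have v: "bounded_chain (Suc v) B' w'" using Cons.prems by simp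
  then have "comp_type (block_path m v c w') = c"
    using Cons.prems by (intro Cons.IH[of v B']) (auto intro: bounded_chain_mono)
  then show ?case
    using Cons.prems block_path_hd[OF v, of m c] by (simp add: comp_type_replicate_N)
qed

text \<open>The height is constant along the east steps, so the last test implies the
  others.\<close>

lemma stays_above_append_E:
  "stays_above m n x y (replicate i E @ P) \<longleftrightarrow>
    (i = 0 \<or> (x + i) * n \<le> y * m) \<and> stays_above m n (x + i) y P"
proof (induction i arbitrary: x)
  case (Suc i)
  have "Suc x * n \<le> (x + Suc i) * n" by (rule mult_le_mono1) simp
  then have "Suc x * n \<le> y * m" if "(x + Suc i) * n \<le> y * m"
    using that by linarith
  with Suc[of "Suc x"] show ?case by (auto simp del: mult_Suc)
qed simp

lemma stays_above_append_N:
  "stays_above m n x y (replicate i N @ P) \<longleftrightarrow> stays_above m n x (y + i) P"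
  by (induction i arbitrary: y) auto

lemma north_columns_append_E: "north_columns x (replicate i E @ P) = north_columns (x + i) P"
  by (induction i arbitrary: x) auto

lemma north_columns_append_N:
  "0 < i \<Longrightarrow> north_columns x (replicate i N @ P) = insert x (north_columns x P)"
  by (induction i rule: nat_induct_non_zero) auto

lemma returns_append_E: "returns m n x y (replicate i E @ P) = returns m n (x + i) y P"
  by (induction i arbitrary: x) auto

lemma returns_append_N_high:
  assumes "x * n + n \<le> y * m"
  shows "returns m n x y (replicate i N @ P) = returns m n x (y + i) P"
  using assms by (induction i arbitrary: y) auto

text \<open>After one north step \<open>y * m - x * n\<close> is at least \<open>m\<close>, hence at
  least \<open>n\<close>; only the lowest step of a block can be a return.\<close>

lemma returns_append_N:
  assumes "0 < i" "x * n \<le> y * m" "n \<le> m"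
  shows "returns m n x y (replicate i N @ P) =
    (if y * m < x * n + n then 1 else 0) + returns m n x (y + i) P"
proof -
  have "x * n + n \<le> Suc y * m" using assms by simp
  from returns_append_N_high[OF this, of "i - 1"] show ?thesis
    using assms(1) by (cases i) auto
qed

text \<open>Block starts have height at most \<open>n\<close>, so their bounds are at most
  \<open>m\<close>; the final east steps run at height \<open>n\<close> to a point on the
  line.\<close>

lemma stays_above_block_path:
  assumes "bounded_chain x (block_bounds m n y c) w" "y + sum_list c = n" "x \<le> m" "0 < n"
  shows "stays_above m n x y (block_path m x c w)"
  using assms
proof (induction c arbitrary: x y w)
  case Nil
  have "m * n \<le> n * m" by simp
  with Nil show ?case
    using stays_above_append_E[of m n x n "m - x" "[]"] by simp
next
  case (Cons a c)
  then obtain v w' where [simp]: "w = v # w'"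
    by (cases w) auto
  from Cons have v: "x \<le> v" "v * n \<le> y * m" "bounded_chain (Suc v) (block_bounds m n (y + a) c) w'"
    by (auto simp: div_ge_iff)
  have "y * m \<le> n * m" using Cons.prems by (intro mult_le_mono1) simp
  with v(2) have "v * n \<le> m * n"
    by (simp only: mult.commute[of m n])
  with \<open>0 < n\<close> have "v \<le> m" by simp
  then have "stays_above m n v (y + a) (block_path m v c w')"
    using Cons.prems v by (intro Cons.IH) (auto intro: bounded_chain_mono)
  then show ?case
    using v by (simp add: stays_above_append_E stays_above_append_N)
qed

lemma north_columns_replicate_E: "north_columns x (replicate i E) = {}"
  using north_columns_append_E[of x i "[]"] by simp

lemma north_columns_block_path:
  assumes "bounded_chain x B w" "0 \<notin> set c" "length B = length c"
  shows "north_columns x (block_path m x c w) = set w"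
  using assms
proof (induction c arbitrary: x B w)
  case Nil
  then show ?case by (simp add: north_columns_replicate_E)
next
  case (Cons a c)
  then obtain b B' v w' where [simp]: "B = b # B'" "w = v # w'"
    by (cases "(x, B, w)" rule: bounded_chain.cases) auto
  have "north_columns v (block_path m v c w') = set w'"
    using Cons.prems by (intro Cons.IH[of v B']) (auto intro: bounded_chain_mono)
  then show ?case
    using Cons.prems by (simp add: north_columns_append_E north_columns_append_N)
qed

lemma returns_block_path:
  assumes "bounded_chain x (block_bounds m n y c) w" "0 \<notin> set c" "0 < n" "n \<le> m"
  shows "returns m n x y (block_path m x c w) = touches (block_bounds m n y c) w"
  using assms
proof (induction c arbitrary: x y w)
  case Nil
  then show ?case
    using returns_append_E[of m n x y "m - x" "[]"] by simp
next
  case (Cons a c)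
  then obtain v w' where [simp]: "w = v # w'"
    by (cases w) auto
  from Cons have v: "x \<le> v" "v * n \<le> y * m" "bounded_chain (Suc v) (block_bounds m n (y + a) c) w'"
    by (auto simp: div_ge_iff)
  have "returns m n v (y + a) (block_path m v c w') = touches (block_bounds m n (y + a) c) w'"
    using Cons.prems v by (intro Cons.IH) (auto intro: bounded_chain_mono)
  \<comment> \<open>The floor is the \<open>v\<close> that is admissible while \<open>Suc v\<close>
    is not.\<close>
  moreover have "y * m < v * n + n \<longleftrightarrow> v = y * m div n"
    using v(2) div_ge_iff[OF \<open>0 < n\<close>, of v y m] div_ge_iff[OF \<open>0 < n\<close>, of "Suc v" y m]
    by auto
  ultimately show ?case
    using v Cons.prems by (simp add: returns_append_E returns_append_N)
qed

lemma zero_notin_comp_type: "0 \<notin> set (comp_type P)"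
  by (induction P rule: comp_type.induct) auto

lemma sum_list_comp_type: "sum_list (comp_type P) = count_list P N"
proof (induction P rule: comp_type.induct)
  case (3 P)
  have "count_list (takeWhile (\<lambda>s. s = N) P) N = length (takeWhile (\<lambda>s. s = N) P)"
    by (induction P) auto
  moreover have "count_list P N =
    count_list (takeWhile (\<lambda>s. s = N) P) N + count_list (dropWhile (\<lambda>s. s = N) P) N"
    unfolding count_list_append[symmetric] by simp
  ultimately show ?case using 3 by simp
qed auto

text \<open>The columns are read off along the recursion of \<open>comp_type\<close>: an east step
  only lowers the start of the chain, a block prepends its column.\<close>

lemma block_path_surj:
  assumes "stays_above m n x y P" "x * n \<le> y * m" "0 < n"
  shows "\<exists>w. bounded_chain x (block_bounds m n y (comp_type P)) w \<and> P = block_path m x (comp_type P) w"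
  using assms
proof (induction P arbitrary: x y rule: comp_type.induct)
  case 1
  then show ?case by simp
next
  case (2 P)
  then have "Suc x * n \<le> y * m" "stays_above m n (Suc x) y P" by simp_all
  from "2.IH"[OF this(2,1) \<open>0 < n\<close>] obtain w where
    w: "bounded_chain (Suc x) (block_bounds m n y (comp_type P)) w"
      "P = block_path m (Suc x) (comp_type P) w" by blast
  \<comment> \<open>This keeps the truncated difference \<open>m - x\<close> positive, so that the
    east step is absorbed even when no block remains.\<close>
  have "x < m"
    using stays_above_iff[of "Suc x" n y m P] \<open>Suc x * n \<le> y * m\<close> \<open>stays_above m n (Suc x) y P\<close>
    by linarith
  then have "Suc (m - Suc x) = m - x" by simp
  then have "E # block_path m (Suc x) (comp_type P) w = block_path m x (comp_type P) w"
    using w(1) by (cases "comp_type P"; cases w) (auto simp flip: replicate_Suc simp: Suc_diff_le)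
  then have "E # P = block_path m x (comp_type (E # P)) w"
    using w(2) by (metis comp_type.simps(2))
  moreover have "bounded_chain x (block_bounds m n y (comp_type (E # P))) w"
    using bounded_chain_mono[OF w(1), of x] by simp
  ultimately show ?case by blast
next
  case (3 P)
  let ?i = "length (takeWhile (\<lambda>s. s = N) P)" and ?Q = "dropWhile (\<lambda>s. s = N) P"
  have "takeWhile (\<lambda>s. s = N) P = replicate ?i N"
    by (rule replicate_length_same[symmetric]) (auto dest: set_takeWhileD)
  then have NP: "N # P = replicate (Suc ?i) N @ ?Q"
    using takeWhile_dropWhile_id[of "\<lambda>s. s = N" P] by simp
  have "stays_above m n x (y + Suc ?i) ?Q"
    using "3.prems"(1) stays_above_append_N unfolding NP by blast
  moreover have "x * n \<le> (y + Suc ?i) * m"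
    using "3.prems"(2) by (simp add: add_mult_distrib)
  ultimately obtain w where
    w: "bounded_chain x (block_bounds m n (y + Suc ?i) (comp_type ?Q)) w"
      "?Q = block_path m x (comp_type ?Q) w"
    using "3.IH" \<open>0 < n\<close> by blast
  have "?Q = [] \<or> hd ?Q = E"
    using hd_dropWhile[of "\<lambda>s. s = N" P] step.exhaust by blast
  \<comment> \<open>Since \<open>?Q\<close> does not begin with a north step, no later block lies in
    column \<open>x\<close>, and the start improves from \<open>x\<close> to
    \<open>Suc x\<close>.\<close>
  have "bounded_chain (Suc x) (block_bounds m n (y + Suc ?i) (comp_type ?Q)) w"
  proof (cases "comp_type ?Q")
    case Nil
    then show ?thesis using w by simp
  next
    case (Cons a c)
    then obtain v w' where [simp]: "w = v # w'" using w by (cases w) auto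
    have "0 < a" using zero_notin_comp_type[of ?Q] Cons by (cases a) auto
    have "v \<noteq> x"
    proof
      assume "v = x"
      with w(2) Cons have "?Q = replicate a N @ block_path m x c w'" by simp
      with \<open>?Q = [] \<or> hd ?Q = E\<close> \<open>0 < a\<close> show False by (cases a) auto
    qed
    then show ?thesis using w(1) Cons by auto
  qed
  moreover have "x \<le> y * m div n"
    using "3.prems" by (simp add: div_ge_iff)
  ultimately have "bounded_chain x (block_bounds m n y (comp_type (N # P))) (x # w)"
    by simp
  moreover have "N # P = block_path m x (comp_type (N # P)) (x # w)"
    using NP w(2) by simp
  ultimately show ?case by blast
qed


section \<open>The ratio-run as an initial run of multiples\<close>

lemma run_from_Min:
  fixes k n :: nat
  assumes "1 \<le> k" "0 \<in> S" "finite S" "card S \<le> n"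
  shows "run_from k 0 (Min {i \<in> {1..n}. k * i \<notin> S}) S"
proof -
  define I where "I = {i \<in> {1..n}. k * i \<notin> S}"
  \<comment> \<open>As \<open>0 \<in> S\<close>, index 0 is excluded automatically; the least
    missing index in \<open>1..n\<close> is therefore the length of the run counted from index
    0.\<close>
  have in_I: "i \<in> I \<longleftrightarrow> i \<le> n \<and> k * i \<notin> S" for i
    using \<open>0 \<in> S\<close> by (cases i) (simp_all add: I_def)
  have "finite I" by (simp add: I_def)
  have "I \<noteq> {}"
  \<comment> \<open>Pigeonhole: the \<open>n + 1\<close> distinct multiples with index in
    \<open>0..n\<close> cannot all lie in \<open>S\<close>.\<close>
  proof
    assume "I = {}"
    then have "(*) k ` {0..n} \<subseteq> S"
      using in_I by (simp add: image_subset_iff)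
    then have "card ((*) k ` {0..n}) \<le> card S"
      by (rule card_mono[OF assms(3)])
    moreover have "card ((*) k ` {0..n}) = Suc n"
      using assms(1) by (subst card_image) (simp_all add: inj_on_def)
    ultimately show False
      using assms(4) by simp
  qed
  with \<open>finite I\<close> have "Min I \<in> I" by (rule Min_in)
  moreover have "k * i \<in> S" if "i < Min I" for i
  proof (rule ccontr)
    assume "k * i \<notin> S"
    with that \<open>Min I \<in> I\<close> have "i \<in> I"
      by (simp add: in_I)
    with \<open>finite I\<close> have "Min I \<le> i"
      by (rule Min_le)
    with that show False by simp
  qed
  ultimately show ?thesis
    unfolding I_def[symmetric] by (simp add: run_from_def in_I)
qed

lemma length_le_sum_list:
  "0 \<notin> set c \<Longrightarrow> length c \<le> sum_list c" for c :: "nat list"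
  by (induction c) auto

lemma ratio_run_block_path:
  assumes "bounded_chain 0 (block_bounds m n 0 c) w" "0 \<notin> set c" "sum_list c = n" "0 < n" "n \<le> m"
  shows "ratio_run m n (block_path m 0 c w) = a \<longleftrightarrow> run_from (m div n) 0 a (set w)"
proof -
  obtain d cs where "c = d # cs" using assms(3,4) by (cases c) auto
  \<comment> \<open>The first block starts at height 0, where the bound is 0.\<close>
  with assms(1) have "0 \<in> set w" by (cases w) auto
  have "card (set w) \<le> length c"
    using card_length[of w] bounded_chain_length[OF assms(1)] by simp
  then have "card (set w) \<le> n"
    using length_le_sum_list[OF assms(2)] assms(3) by simp
  moreover have "1 \<le> m div n"
    using assms by (simp add: Suc_le_eq div_greater_zero_iff)
  ultimately have "run_from (m div n) 0 (ratio_run m n (block_path m 0 c w)) (set w)"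
    unfolding ratio_run_def set_coarea
    using run_from_Min \<open>0 \<in> set w\<close> assms by (simp add: north_columns_block_path)
  then show ?thesis
    using run_from_unique by blast
qed

text \<open>The path determines its set of columns, and a strictly increasing list is determined by
  its set.\<close>

lemma block_path_inj:
  assumes "0 \<notin> set c" "length B = length c"
  shows "inj_on (block_path m x c) {w. bounded_chain x B w}"
proof (rule inj_onI, clarsimp)
  fix w w'
  assume w: "bounded_chain x B w" "bounded_chain x B w'" "block_path m x c w = block_path m x c w'"
  then have "set w = set w'"
    using north_columns_block_path assms by metis
  with w show "w = w'"
    by (metis bounded_chain_sorted strict_sorted_equal)
qed

section \<open>Equinumerous classes of paths and the involution\<close>

definition path_class :: "nat \<Rightarrow> nat \<Rightarrow> nat list \<Rightarrow> nat \<Rightarrow> nat \<Rightarrow> path set" where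
  "path_class m n c a b =
     {P \<in> dyck_paths m n. comp_type P = c \<and> ratio_run m n P = a \<and> ret m n P = b}"

lemma path_class_eq_image:
  assumes "0 < n" "n \<le> m" "0 \<notin> set c" "sum_list c = n"
  shows "path_class m n c a b = block_path m 0 c `
    {w. bounded_chain 0 (block_bounds m n 0 c) w \<and> run_from (m div n) 0 a (set w) \<and>
      touches (block_bounds m n 0 c) w = b}" (is "_ = _ ` ?W")
proof -
  have "0 < m" using assms by simp
  note stat = ratio_run_block_path[OF _ assms(3,4,1,2)]
    ret_eq_returns returns_block_path[OF _ assms(3,1,2)]
  show ?thesis
  proof (intro equalityI subsetI)
    fix P assume "P \<in> path_class m n c a b"
    then have P: "stays_above m n 0 0 P" "comp_type P = c" "ratio_run m n P = a" "ret m n P = b"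
      using dyck_paths_iff[OF \<open>0 < m\<close>] by (auto simp: path_class_def)
    from block_path_surj[OF P(1)] assms(1) P(2) obtain w where
      w: "bounded_chain 0 (block_bounds m n 0 c) w" "P = block_path m 0 c w"
      by auto
    then have "w \<in> ?W"
      using P(3,4) stat by simp
    with w show "P \<in> block_path m 0 c ` ?W" by blast
  next
    fix P assume "P \<in> block_path m 0 c ` ?W"
    then obtain w where w: "P = block_path m 0 c w" "w \<in> ?W" by blast
    then show "P \<in> path_class m n c a b"
      using stat stays_above_block_path[of 0 m n 0 c w] comp_type_block_path[of 0 _ w c m] assms
        dyck_paths_iff[OF \<open>0 < m\<close>]
      by (auto simp: path_class_def)
  qed
qed

text \<open>Lists that are not compositions of \<open>n\<close> must be covered too, since the
  gluing lemma asks for equal cardinalities for every \<open>c\<close>.\<close>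

lemma path_class_empty:
  assumes "0 < m" "0 \<in> set c \<or> sum_list c \<noteq> n"
  shows "path_class m n c a b = {}"
proof -
  have "0 \<notin> set (comp_type P)" "sum_list (comp_type P) = n" if "P \<in> dyck_paths m n" for P
    using that zero_notin_comp_type stays_above_iff[of 0 n 0 m P] dyck_paths_iff[OF assms(1)]
    by (auto simp: sum_list_comp_type)
  with assms(2) show ?thesis by (auto simp: path_class_def)
qed

lemma path_class_card:
  assumes "0 < n" "n \<le> m"
  shows "finite (path_class m n c a b)"
    and "card (path_class m n c a b) = card (path_class m n c b a)"
proof -
  have "finite (path_class m n c a b) \<and>
    card (path_class m n c a b) = card (path_class m n c b a)"
  proof (cases "0 \<in> set c \<or> sum_list c \<noteq> n")
    case True
    then show ?thesis using path_class_empty[of m] assms by simp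
  next
    case False
    then have c: "0 \<notin> set c" "sum_list c = n" by auto
    let ?B = "block_bounds m n 0 c"
    have card: "card (path_class m n c a b) = joint_count (m div n) 0 0 ?B a b" for a b
      unfolding path_class_eq_image[OF assms c] joint_count_def
      by (intro card_image inj_on_subset[OF block_path_inj[OF c(1), of ?B]]) auto
    have "1 \<le> m div n"
      using assms by (simp add: Suc_le_eq div_greater_zero_iff)
    then have "joint_count (m div n) 0 0 ?B a b = joint_count (m div n) 0 0 ?B b a"
      using spaced_block_bounds[OF c(1)] by (intro joint_count_sym) auto
    moreover have "finite (path_class m n c a b)"
      unfolding path_class_eq_image[OF assms c]
      by (intro finite_imageI finite_subset[OF _ finite_bounded_chain[of 0 ?B]]) auto
    ultimately show ?thesis using card by simp
  qed
  then show "finite (path_class m n c a b)"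
    and "card (path_class m n c a b) = card (path_class m n c b a)" by auto
qed

text \<open>Equal cardinalities give bijections between swapped classes; these are glued into one
  map on \<open>D\<close>.\<close>

lemma involution_swapping_statistics:
  fixes D :: "'a set" and type :: "'a \<Rightarrow> 'c" and s t :: "'a \<Rightarrow> 'b :: linorder"
  defines "X \<equiv> \<lambda>c a b. {P \<in> D. type P = c \<and> s P = a \<and> t P = b}"
  assumes "\<And>c a b. finite (X c a b)" "\<And>c a b. card (X c a b) = card (X c b a)"
  shows "\<exists>\<Psi>. \<Psi> \<in> D \<rightarrow> D \<and>
    (\<forall>P \<in> D. \<Psi> (\<Psi> P) = P \<and> type (\<Psi> P) = type P \<and> s (\<Psi> P) = t P \<and> t (\<Psi> P) = s P)"
proof -
  have "\<exists>f. bij_betw f (X c a b) (X c b a)" for c a b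
    using assms by (intro finite_same_card_bij) auto
  then obtain f where f: "\<And>c a b. bij_betw (f c a b) (X c a b) (X c b a)"
    by metis
  \<comment> \<open>Independently chosen \<open>f c a b\<close> and \<open>f c b a\<close> need not
    be mutually inverse. The linear order keeps the one with \<open>a < b\<close> and uses its
    inverse for the opposite direction; the diagonal is fixed.\<close>
  define g where "g c a b =
    (if a < b then f c a b else if a = b then id else inv_into (X c b a) (f c b a))" for c a b
  have g: "g c a b P \<in> X c b a" if "P \<in> X c a b" for c a b P
    using that bij_betw_apply[OF f] bij_betw_apply[OF bij_betw_inv_into[OF f]]
    by (auto simp: g_def)
  have gg: "g c b a (g c a b P) = P" if "P \<in> X c a b" for c a b P
    using that bij_betw_inv_into_left[OF f] bij_betw_inv_into_right[OF f]
    by (auto simp: g_def)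
  define \<Psi> where "\<Psi> P = g (type P) (s P) (t P) P" for P
  have "\<Psi> P \<in> D \<and> \<Psi> (\<Psi> P) = P \<and> type (\<Psi> P) = type P \<and> s (\<Psi> P) = t P \<and> t (\<Psi> P) = s P"
    if "P \<in> D" for P
  proof -
    have P: "P \<in> X (type P) (s P) (t P)" using that by (simp add: X_def)
    have "\<Psi> P \<in> X (type P) (t P) (s P)"
      unfolding \<Psi>_def by (rule g[OF P])
    then have *: "\<Psi> P \<in> D" "type (\<Psi> P) = type P" "s (\<Psi> P) = t P" "t (\<Psi> P) = s P"
      by (auto simp: X_def)
    then have "\<Psi> (\<Psi> P) = g (type P) (t P) (s P) (\<Psi> P)"
      by (simp add: \<Psi>_def[of "\<Psi> P"])
    also have "\<dots> = P"
      unfolding \<Psi>_def by (rule gg[OF P])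
    finally show ?thesis using * by blast
  qed
  then show ?thesis by (intro exI[of _ \<Psi>]) auto
qed

theorem theorem3p6:
  fixes m n :: nat
  assumes "0 < n" and "n < m"
  shows "\<exists>\<Psi>. \<Psi> \<in> dyck_paths m n \<rightarrow> dyck_paths m n \<and>
    (\<forall>P \<in> dyck_paths m n.
       \<Psi> (\<Psi> P) = P \<and>
       comp_type (\<Psi> P) = comp_type P \<and>
       ratio_run m n (\<Psi> P) = ret m n P \<and>
       ret m n (\<Psi> P) = ratio_run m n P)"
  using path_class_card[OF assms(1) less_imp_le[OF assms(2)]]
  unfolding path_class_def by (rule involution_swapping_statistics)

end
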